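(* There exists a universal constant $c>0$ such that for all $n$ and $k\in[n]$, $$\inf_{\widehat{\theta}}\sup_{\theta^*\in\Theta_{k}^{\uparrow}}\mathbb{E}\|\widehat{\theta}-\theta^*\|^2\geq \begin{cases} c\sigma^2, & k=1, \\ c\sigma^2k\log\log(16n/k), & k\geq 2, \end{cases}$$ where the infimum is over all measurable functions $\widehat\theta$ of $X$ and the expectation is under $X\sim N(\theta^*,\sigma^2 I_n)$.
   Context: $[n]=\{1,\dots,n\}$. For reals $a\le b$, $(a:b]$ is the set of integers $i$ with $a<i\le b$. For $k\in[n]$, $\Theta_k^{\uparrow}$ is the set of $\theta\in\mathbb{R}^n$ for which there exist integers $0=a_0\le a_1\le\cdots\le a_k=n$ and reals $\mu_1\le\cdots\le\mu_k$ with $\theta_i=\mu_j$ for all $i\in(a_{j-1}:a_j]$. *)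

theory Defs
  imports "HOL-Probability.Probability"
begin

text \<open>Vectors in R^n are represented as functions nat => real, extensional on {..<n};
  coordinate i (0-based) corresponds to the paper's coordinate i+1.\<close>

definition Theta_up :: "nat \<Rightarrow> nat \<Rightarrow> (nat \<Rightarrow> real) set" where
  "Theta_up n k = {\<theta>. \<theta> \<in> extensional {..<n} \<and>
     (\<exists>(a::nat \<Rightarrow> nat) (\<mu>::nat \<Rightarrow> real).
        a 0 = 0 \<and> a k = n \<and> (\<forall>j\<in>{1..k}. a (j - 1) \<le> a j) \<and>
        (\<forall>j\<in>{1..k}. \<forall>j'\<in>{1..k}. j \<le> j' \<longrightarrow> \<mu> j \<le> \<mu> j') \<and>
        (\<forall>j\<in>{1..k}. \<forall>i::nat. a (j - 1) < i \<and> i \<le> a j \<longrightarrow> \<theta> (i - 1) = \<mu> j))}"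

definition gauss_vec :: "nat \<Rightarrow> real \<Rightarrow> (nat \<Rightarrow> real) \<Rightarrow> (nat \<Rightarrow> real) measure" where
  "gauss_vec n \<sigma> \<theta> = PiM {..<n} (\<lambda>i. density lborel (normal_density (\<theta> i) \<sigma>))"

definition risk :: "nat \<Rightarrow> real \<Rightarrow> ((nat \<Rightarrow> real) \<Rightarrow> (nat \<Rightarrow> real)) \<Rightarrow> (nat \<Rightarrow> real) \<Rightarrow> ennreal" where
  "risk n \<sigma> est \<theta> = (\<integral>\<^sup>+ x. ennreal (\<Sum>i<n. (est x i - \<theta> i)\<^sup>2) \<partial>gauss_vec n \<sigma> \<theta>)"

end

theory Submission
  imports Defs
begin

text \<open>
  Cut the coordinates into \<open>K = k div 2\<close> blocks of length \<open>m = n div K\<close>. On a block one may lower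
  the signal on the first \<open>2 ^ v\<close> coordinates by an amount whose squared norm is always
  \<open>\<sigma>\<^sup>2 ln M / 2\<close>, where \<open>v < M\<close> and \<open>M\<close> is about \<open>log m\<close>; different \<open>v\<close> are separated by a
  constant fraction of this norm. The \<open>M\<close> Gaussian laws cannot be told apart: if \<open>p\<^sub>0\<close> is the
  density of the unperturbed law and \<open>p\<^sub>v\<close> those of the perturbed ones, then for every \<open>s > 0\<close>
  \<open>max p\<^sub>v \<le> (s p\<^sub>0 + \<Sum> p\<^sub>v\<^sup>2 / (s p\<^sub>0)) / 2\<close>, and \<open>\<integral> p\<^sub>v\<^sup>2 / p\<^sub>0 \<le> \<surd>M\<close>. So every estimator
  pays a multiple of \<open>\<sigma>\<^sup>2 ln M\<close> on each block, on average over independent uniform choices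
  of \<open>v\<close>, and \<open>ln M\<close> is of order \<open>log log (16 n / k)\<close>. Increasing offsets between blocks keep the
  signal monotone. For \<open>k = 1\<close> the same bound is applied to two constant signals.
\<close>

section \<open>Densities of Gaussian vectors\<close>

definition gauss_pdf :: "nat \<Rightarrow> real \<Rightarrow> (nat \<Rightarrow> real) \<Rightarrow> (nat \<Rightarrow> real) \<Rightarrow> real" where
  "gauss_pdf n \<sigma> \<theta> x = (\<Prod>i<n. normal_density (\<theta> i) \<sigma> (x i))"

lemma gauss_pdf_pos: "\<sigma> > 0 \<Longrightarrow> gauss_pdf n \<sigma> \<theta> x > 0"
  unfolding gauss_pdf_def by (intro prod_pos) (auto intro: normal_density_pos)

lemma gauss_pdf_measurable [measurable]:
  "gauss_pdf n \<sigma> \<theta> \<in> borel_measurable (PiM {..<n} (\<lambda>_. lborel))"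
  unfolding gauss_pdf_def by measurable

text \<open>Puts all the laws on one dominating measure, so that they can be compared pointwise
  through their densities. Both sides agree on boxes, where the integral factorises.\<close>

lemma gauss_vec_eq_density:
  assumes "\<sigma> > 0"
  shows "gauss_vec n \<sigma> \<theta> = density (PiM {..<n} (\<lambda>_. lborel)) (\<lambda>x. ennreal (gauss_pdf n \<sigma> \<theta> x))"
proof -
  interpret L: product_sigma_finite "\<lambda>_::nat. lborel :: real measure" ..
  have ps: "prob_space (density lborel (normal_density (\<theta> i) \<sigma>))" for i
    using prob_space_normal_density[OF assms] .
  interpret N: product_prob_space "\<lambda>i::nat. density lborel (normal_density (\<theta> i) \<sigma>)"
    using ps by (auto simp: product_prob_space_def product_sigma_finite_def
        product_prob_space_axioms_def prob_space_imp_sigma_finite)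
  show ?thesis unfolding gauss_vec_def
  proof (rule N.PiM_eqI[symmetric])
    show "sets (density (PiM {..<n} (\<lambda>_. lborel)) (\<lambda>x. ennreal (gauss_pdf n \<sigma> \<theta> x)))
      = sets (PiM {..<n} (\<lambda>i. density lborel (normal_density (\<theta> i) \<sigma>)))"
      by (auto intro!: sets_PiM_cong)
  next
    fix A assume "\<And>i. i \<in> {..<n} \<Longrightarrow> A i \<in> sets (density lborel (normal_density (\<theta> i) \<sigma>))"
    hence A[measurable]: "\<And>i. i < n \<Longrightarrow> A i \<in> sets borel" by simp
    have "emeasure (density (PiM {..<n} (\<lambda>_. lborel)) (\<lambda>x. ennreal (gauss_pdf n \<sigma> \<theta> x))) (Pi\<^sub>E {..<n} A)
      = (\<integral>\<^sup>+x. ennreal (gauss_pdf n \<sigma> \<theta> x) * indicator (Pi\<^sub>E {..<n} A) x \<partial>PiM {..<n} (\<lambda>_. lborel))"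
      by (subst emeasure_density) (auto intro!: sets_PiM_I_finite)
    also have "\<dots> = (\<integral>\<^sup>+x. (\<Prod>i<n. ennreal (normal_density (\<theta> i) \<sigma> (x i)) * indicator (A i) (x i))
       \<partial>PiM {..<n} (\<lambda>_. lborel))"
    proof (rule nn_integral_cong)
      fix x assume "x \<in> space (PiM {..<n} (\<lambda>_. lborel :: real measure))"
      hence ext: "x \<in> extensional {..<n}" by (simp add: space_PiM PiE_def)
      have "indicator (Pi\<^sub>E {..<n} A) x = (\<Prod>i<n. indicator (A i) (x i) :: ennreal)"
      proof (cases "x \<in> Pi\<^sub>E {..<n} A")
        case False
        with ext obtain i where "i < n" "x i \<notin> A i" by (auto simp: PiE_iff)
        hence "(\<Prod>i<n. indicator (A i) (x i) :: ennreal) = 0" by (intro prod_zero) (auto simp: indicator_def)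
        with False show ?thesis by simp
      next
        case True
        hence "\<And>i. i < n \<Longrightarrow> x i \<in> A i" by auto
        with True show ?thesis by simp
      qed
      thus "ennreal (gauss_pdf n \<sigma> \<theta> x) * indicator (Pi\<^sub>E {..<n} A) x
        = (\<Prod>i<n. ennreal (normal_density (\<theta> i) \<sigma> (x i)) * indicator (A i) (x i))"
        by (simp add: gauss_pdf_def prod.distrib prod_ennreal)
    qed
    also have "\<dots> = (\<Prod>i<n. \<integral>\<^sup>+y. ennreal (normal_density (\<theta> i) \<sigma> y) * indicator (A i) y \<partial>lborel)"
      by (rule L.product_nn_integral_prod) auto
    also have "\<dots> = (\<Prod>i\<in>{..<n}. emeasure (density lborel (normal_density (\<theta> i) \<sigma>)) (A i))"
      by (intro prod.cong) (auto simp: emeasure_density)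
    finally show "emeasure (density (PiM {..<n} (\<lambda>_. lborel)) (\<lambda>x. ennreal (gauss_pdf n \<sigma> \<theta> x))) (Pi\<^sub>E {..<n} A)
      = (\<Prod>i\<in>{..<n}. emeasure (density lborel (normal_density (\<theta> i) \<sigma>)) (A i))" .
  qed auto
qed

lemma nn_integral_gauss_pdf:
  assumes "\<sigma> > 0"
  shows "(\<integral>\<^sup>+x. ennreal (gauss_pdf n \<sigma> \<theta> x) \<partial>PiM {..<n} (\<lambda>_. lborel)) = 1"
proof -
  have "prob_space (gauss_vec n \<sigma> \<theta>)"
    unfolding gauss_vec_def by (intro prob_space_PiM prob_space_normal_density assms)
  from prob_space.emeasure_space_1[OF this] show ?thesis
    by (simp add: gauss_vec_eq_density[OF assms] emeasure_density cong: nn_integral_cong)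
qed

lemma nn_integral_gauss_vec:
  assumes "\<sigma> > 0" "f \<in> borel_measurable (PiM {..<n} (\<lambda>_. lborel))" "\<And>x. f x \<ge> 0"
  shows "(\<integral>\<^sup>+x. ennreal (f x) \<partial>gauss_vec n \<sigma> \<theta>)
    = (\<integral>\<^sup>+x. ennreal (gauss_pdf n \<sigma> \<theta> x * f x) \<partial>PiM {..<n} (\<lambda>_. lborel))"
  using assms(2) gauss_pdf_pos[OF assms(1)] assms(3)
  by (simp add: gauss_vec_eq_density[OF assms(1)] nn_integral_density ennreal_mult less_imp_le)

text \<open>Completing the square in each coordinate. The last factor is again a probability
  density, centred at the reflection of \<open>\<eta>\<close> in \<open>\<theta>\<close>. Dividing
  by the density at \<open>\<eta>\<close> and integrating therefore shows that the chi-square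
  integral is the exponential factor.\<close>

lemma gauss_pdf_square:
  assumes "\<sigma> > 0"
  shows "(gauss_pdf n \<sigma> \<theta> x)\<^sup>2 = exp ((\<Sum>i<n. (\<theta> i - \<eta> i)\<^sup>2) / \<sigma>\<^sup>2)
    * gauss_pdf n \<sigma> \<eta> x * gauss_pdf n \<sigma> (\<lambda>i. 2 * \<theta> i - \<eta> i) x"
proof -
  have "(normal_density a \<sigma> y)\<^sup>2
      = exp ((a - b)\<^sup>2 / \<sigma>\<^sup>2) * normal_density b \<sigma> y * normal_density (2 * a - b) \<sigma> y" for a b y
  proof -
    have e: "2 * (-(y - a)\<^sup>2 / (2 * \<sigma>\<^sup>2)) = (a - b)\<^sup>2 / \<sigma>\<^sup>2
        + (-(y - b)\<^sup>2 / (2 * \<sigma>\<^sup>2)) + (-(y - (2 * a - b))\<^sup>2 / (2 * \<sigma>\<^sup>2))"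
      using assms by (simp add: field_simps power2_eq_square)
    have "(exp (-(y - a)\<^sup>2 / (2 * \<sigma>\<^sup>2)))\<^sup>2 = exp ((a - b)\<^sup>2 / \<sigma>\<^sup>2)
        * exp (-(y - b)\<^sup>2 / (2 * \<sigma>\<^sup>2)) * exp (-(y - (2 * a - b))\<^sup>2 / (2 * \<sigma>\<^sup>2))"
      unfolding exp_add[symmetric] e[symmetric] by (rule exp_double[symmetric])
    thus ?thesis unfolding normal_density_def by (simp add: power2_eq_square)
  qed
  hence "(\<Prod>i<n. (normal_density (\<theta> i) \<sigma> (x i))\<^sup>2) = (\<Prod>i<n. exp ((\<theta> i - \<eta> i)\<^sup>2 / \<sigma>\<^sup>2)
      * normal_density (\<eta> i) \<sigma> (x i) * normal_density (2 * \<theta> i - \<eta> i) \<sigma> (x i))"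
    by (intro prod.cong) auto
  thus ?thesis
    by (simp add: gauss_pdf_def prod.distrib prod_power_distrib exp_sum sum_divide_distrib)
qed

section \<open>Testing among many Gaussian laws\<close>

text \<open>Pointwise core of the testing bound. By separation at most one index has loss below
  \<open>d / 2\<close>. The other indices pay for themselves, and the exceptional density is
  controlled by \<open>p0\<close> and the bound on its square. In the application \<open>q v\<close>
  is the reflected density and \<open>E\<close> bounds the exponential factor of
  \<open>gauss_pdf_square\<close>.\<close>

lemma weighted_loss_ge:
  fixes p w q :: "'v \<Rightarrow> real"
  assumes "finite V" "d > 0" "s > 0" "E \<ge> 0" "p0 > 0"
    and pos: "\<And>v. v \<in> V \<Longrightarrow> p v \<ge> 0" "\<And>v. v \<in> V \<Longrightarrow> q v \<ge> 0" "\<And>v. v \<in> V \<Longrightarrow> w v \<ge> 0"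
    and sq: "\<And>v. v \<in> V \<Longrightarrow> (p v)\<^sup>2 \<le> E * p0 * q v"
    and sep: "\<And>u v. u \<in> V \<Longrightarrow> v \<in> V \<Longrightarrow> u \<noteq> v \<Longrightarrow> w u + w v \<ge> d"
  shows "(\<Sum>v\<in>V. d / 2 * p v)
    \<le> (\<Sum>v\<in>V. p v * w v) + d / 2 * (s / 2 * p0 + (\<Sum>v\<in>V. E / (2 * s) * q v))"
proof -
  have rest: "s / 2 * p0 + (\<Sum>v\<in>V. E / (2 * s) * q v) \<ge> 0"
    using assms by (intro add_nonneg_nonneg sum_nonneg mult_nonneg_nonneg) auto
  show ?thesis
  proof (cases "\<forall>v\<in>V. w v \<ge> d / 2")
    case True
    hence "(\<Sum>v\<in>V. d / 2 * p v) \<le> (\<Sum>v\<in>V. p v * w v)"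
      using pos by (intro sum_mono) (metis mult.commute mult_left_mono)
    thus ?thesis using rest \<open>d > 0\<close> by (smt (verit) mult_nonneg_nonneg divide_nonneg_pos)
  next
    case False
    then obtain u where u: "u \<in> V" "w u < d / 2" by auto
    have oth: "w v \<ge> d / 2" if "v \<in> V - {u}" for v
      using sep[of u v] u that by auto
    have "(\<Sum>v\<in>V-{u}. d / 2 * p v) \<le> (\<Sum>v\<in>V-{u}. p v * w v)"
      using pos oth by (intro sum_mono) (metis mult.commute mult_left_mono Diff_iff)
    also have "\<dots> \<le> (\<Sum>v\<in>V. p v * w v)"
      using pos \<open>finite V\<close> by (intro sum_mono2) auto
    finally have 1: "(\<Sum>v\<in>V-{u}. d / 2 * p v) \<le> (\<Sum>v\<in>V. p v * w v)" .
    \<comment> \<open>AM-GM with a free weight \<open>s\<close>, to be optimised after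
      integration.\<close>
    have "2 * (s * p0) * p u \<le> (s * p0)\<^sup>2 + (p u)\<^sup>2"
      using sum_squares_bound[of "s * p0" "p u"] by simp
    also have "\<dots> \<le> (s * p0)\<^sup>2 + E * p0 * q u" using sq[OF u(1)] by simp
    finally have "p u \<le> ((s * p0)\<^sup>2 + E * p0 * q u) / (2 * (s * p0))"
      using \<open>s > 0\<close> \<open>p0 > 0\<close> by (simp add: pos_le_divide_eq mult.commute)
    also have "\<dots> = s / 2 * p0 + E / (2 * s) * q u"
      using \<open>s > 0\<close> \<open>p0 > 0\<close> by (simp add: field_simps power2_eq_square)
    \<comment> \<open>Summing over all of \<open>V\<close> removes the dependence on
      \<open>u\<close>, which changes with the observation.\<close>
    also have "\<dots> \<le> s / 2 * p0 + (\<Sum>v\<in>V. E / (2 * s) * q v)"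
      using u(1) \<open>finite V\<close> assms by (intro add_left_mono member_le_sum) auto
    finally have "d / 2 * p u \<le> d / 2 * (s / 2 * p0 + (\<Sum>v\<in>V. E / (2 * s) * q v))"
      using \<open>d > 0\<close> by (intro mult_left_mono) auto
    thus ?thesis using 1 by (simp only: sum.remove[OF \<open>finite V\<close> u(1), of "\<lambda>v. d / 2 * p v"])
  qed
qed

text \<open>Integrates \<open>weighted_loss_ge\<close>. All densities have mass 1, so the correction
  costs \<open>d / 2 * (s / 2 + M * E / (2 * s))\<close> out of \<open>d / 2 * M\<close>, where
  \<open>M\<close> is the number of hypotheses.\<close>

lemma gaussian_testing_lower_bound:
  fixes \<theta> :: "'v \<Rightarrow> nat \<Rightarrow> real" and w :: "'v \<Rightarrow> (nat \<Rightarrow> real) \<Rightarrow> real"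
  assumes V: "finite V" "card V \<ge> 2" and "\<sigma> > 0" "d > 0"
    and w: "\<And>v. v \<in> V \<Longrightarrow> w v \<in> borel_measurable (PiM {..<n} (\<lambda>_. lborel))"
      "\<And>v x. w v x \<ge> 0"
    and sep: "\<And>u v x. u \<in> V \<Longrightarrow> v \<in> V \<Longrightarrow> u \<noteq> v \<Longrightarrow> w u x + w v x \<ge> d"
    and close: "\<And>v. v \<in> V \<Longrightarrow> (\<Sum>i<n. (\<theta> v i - \<eta> i)\<^sup>2) \<le> \<sigma>\<^sup>2 * (ln (card V) / 2)"
  shows "(\<Sum>v\<in>V. \<integral>\<^sup>+x. ennreal (w v x) \<partial>gauss_vec n \<sigma> (\<theta> v))
    \<ge> ennreal (d / 2 * (1 - 2 powr (-1/4)) * card V)"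
proof -
  define M where "M = real (card V)"
  have M: "M \<ge> 2" using V by (simp add: M_def)
  \<comment> \<open>\<open>E\<close> is the exponential of the allowed \<open>ln M / 2\<close>. The
    weight \<open>s\<close> is the square root of \<open>M * E\<close>, which minimises
    \<open>s / 2 + M * E / (2 * s)\<close>; the minimum is \<open>s\<close> itself.\<close>
  define s where "s = M powr (3/4)"
  define E where "E = M powr (1/2)"
  have s: "s > 0" and E: "E \<ge> 0" using M by (auto simp: s_def E_def)
  let ?L = "PiM {..<n} (\<lambda>_. lborel :: real measure)"
  let ?p = "\<lambda>v. gauss_pdf n \<sigma> (\<theta> v)" and ?r = "gauss_pdf n \<sigma> \<eta>"
  let ?q = "\<lambda>v. gauss_pdf n \<sigma> (\<lambda>i. 2 * \<theta> v i - \<eta> i)"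
  note pos = gauss_pdf_pos[OF \<open>\<sigma> > 0\<close>]
  note nonneg = less_imp_le[OF pos]
  note int1 = nn_integral_gauss_pdf[OF \<open>\<sigma> > 0\<close>]
  note [measurable] = w(1)
  have sq: "(?p v x)\<^sup>2 \<le> E * ?r x * ?q v x" if "v \<in> V" for v x
  proof -
    have "(\<Sum>i<n. (\<theta> v i - \<eta> i)\<^sup>2) / \<sigma>\<^sup>2 \<le> ln M / 2"
      using close[OF that] \<open>\<sigma> > 0\<close> by (simp add: pos_divide_le_eq M_def mult.commute)
    hence "exp ((\<Sum>i<n. (\<theta> v i - \<eta> i)\<^sup>2) / \<sigma>\<^sup>2) \<le> E"
      using M by (simp add: E_def powr_def)
    thus ?thesis unfolding gauss_pdf_square[OF \<open>\<sigma> > 0\<close>, of n "\<theta> v" x \<eta>]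
      by (intro mult_right_mono nonneg)
  qed
  let ?R = "\<Sum>v\<in>V. \<integral>\<^sup>+x. ennreal (w v x) \<partial>gauss_vec n \<sigma> (\<theta> v)"
  have "ennreal (d / 2 * M) = (\<Sum>v\<in>V. \<integral>\<^sup>+x. ennreal (d / 2) * ennreal (?p v x) \<partial>?L)"
  proof -
    have "ennreal (d / 2 * M) = ennreal M * ennreal (d / 2)"
      using \<open>d > 0\<close> M by (subst ennreal_mult[symmetric]) (auto simp: mult.commute)
    thus ?thesis by (simp add: nn_integral_cmult int1 M_def ennreal_of_nat_eq_real_of_nat)
  qed
  also have "\<dots> = (\<integral>\<^sup>+x. ennreal (\<Sum>v\<in>V. d / 2 * ?p v x) \<partial>?L)"
    using \<open>d > 0\<close> nonneg
    by (subst nn_integral_sum[symmetric]) (auto simp: ennreal_mult[symmetric] intro!: nn_integral_cong sum_ennreal)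
  also have "\<dots> \<le> (\<integral>\<^sup>+x. ennreal ((\<Sum>v\<in>V. ?p v x * w v x)
      + d / 2 * (s / 2 * ?r x + (\<Sum>v\<in>V. E / (2 * s) * ?q v x))) \<partial>?L)"
    by (intro nn_integral_mono ennreal_leI weighted_loss_ge)
      (use V \<open>d > 0\<close> s E pos nonneg w(2) sq sep in auto)
  also have "\<dots> = (\<integral>\<^sup>+x. (\<Sum>v\<in>V. ennreal (?p v x * w v x))
      + ennreal (d / 2) * (ennreal (s / 2) * ennreal (?r x)
          + (\<Sum>v\<in>V. ennreal (E / (2 * s)) * ennreal (?q v x))) \<partial>?L)"
  proof (rule nn_integral_cong)
    fix x
    have "s / 2 * ?r x \<ge> 0" "(\<Sum>v\<in>V. E / (2 * s) * ?q v x) \<ge> 0"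
      using s E nonneg by (auto intro!: sum_nonneg)
    hence "ennreal (d / 2 * (s / 2 * ?r x + (\<Sum>v\<in>V. E / (2 * s) * ?q v x)))
      = ennreal (d / 2) * (ennreal (s / 2 * ?r x) + ennreal (\<Sum>v\<in>V. E / (2 * s) * ?q v x))"
      using \<open>d > 0\<close> by (subst ennreal_plus[symmetric]; (subst ennreal_mult[symmetric])?) auto
    moreover have "ennreal (\<Sum>v\<in>V. E / (2 * s) * ?q v x) = (\<Sum>v\<in>V. ennreal (E / (2 * s)) * ennreal (?q v x))"
      using s E nonneg by (simp add: ennreal_mult[symmetric])
    moreover have "ennreal (\<Sum>v\<in>V. ?p v x * w v x) = (\<Sum>v\<in>V. ennreal (?p v x * w v x))"
      using nonneg w(2) by (subst sum_ennreal[symmetric]) auto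
    moreover have "ennreal (s / 2 * ?r x) = ennreal (s / 2) * ennreal (?r x)"
      using s nonneg by (simp add: ennreal_mult[symmetric])
    moreover have "(\<Sum>v\<in>V. ?p v x * w v x) \<ge> 0"
      using nonneg w(2) by (auto intro!: sum_nonneg)
    moreover have "d / 2 * (s / 2 * ?r x + (\<Sum>v\<in>V. E / (2 * s) * ?q v x)) \<ge> 0"
      using \<open>d > 0\<close> s E nonneg by (auto intro!: add_nonneg_nonneg sum_nonneg mult_nonneg_nonneg)
    ultimately show "ennreal ((\<Sum>v\<in>V. ?p v x * w v x)
        + d / 2 * (s / 2 * ?r x + (\<Sum>v\<in>V. E / (2 * s) * ?q v x)))
      = (\<Sum>v\<in>V. ennreal (?p v x * w v x))
        + ennreal (d / 2) * (ennreal (s / 2) * ennreal (?r x)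
          + (\<Sum>v\<in>V. ennreal (E / (2 * s)) * ennreal (?q v x)))"
      by (simp only: ennreal_plus)
  qed
  also have "\<dots> = ?R + ennreal (d / 2) * (ennreal (s / 2) + of_nat (card V) * ennreal (E / (2 * s)))"
    using w(2)
    by (simp add: nn_integral_add nn_integral_sum nn_integral_cmult int1
        nn_integral_gauss_vec[OF \<open>\<sigma> > 0\<close> w(1)])
  also have "ennreal (d / 2) * (ennreal (s / 2) + of_nat (card V) * ennreal (E / (2 * s)))
      = ennreal (d / 2 * (s / 2 + M * (E / (2 * s))))"
    using \<open>d > 0\<close> s E M
    by (simp add: ennreal_mult[symmetric] ennreal_plus[symmetric] ennreal_of_nat_eq_real_of_nat M_def
        del: ennreal_plus)
  also have "s / 2 + M * (E / (2 * s)) = s"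
  proof -
    have "s * s = M * E" using M by (simp add: s_def E_def powr_add[symmetric] powr_mult_base)
    thus ?thesis using s by (simp add: field_simps)
  qed
  finally have le: "ennreal (d / 2 * M) \<le> ?R + ennreal (d / 2 * s)" .
  \<comment> \<open>As \<open>M\<close> is at least 2, the cost \<open>s\<close> is at most a fixed
    fraction of \<open>M\<close>, and the rest survives.\<close>
  have "s = M * M powr (-1/4)" using M by (simp add: s_def powr_mult_base)
  also have "\<dots> \<le> M * 2 powr (-1/4)"
    using M by (intro mult_left_mono powr_mono2') auto
  finally have "d / 2 * (1 - 2 powr (-1/4)) * M \<le> d / 2 * M - d / 2 * s"
    using \<open>d > 0\<close> by (simp add: field_simps)
  hence "ennreal (d / 2 * (1 - 2 powr (-1/4)) * M) \<le> ennreal (d / 2 * M) - ennreal (d / 2 * s)"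
    using \<open>d > 0\<close> s by (simp add: ennreal_minus ennreal_leI)
  also have "\<dots> \<le> ?R" using le by (simp add: ennreal_minus_le_iff add.commute)
  finally show ?thesis by (simp add: M_def)
qed

section \<open>Product averages and staircase signals\<close>

text \<open>Allows the choice in one block to be summed first, with the choices in all other blocks
  frozen.\<close>

lemma sum_PiE_remove:
  assumes "j \<in> A"
  shows "(\<Sum>f\<in>Pi\<^sub>E A B. F f) = (\<Sum>g\<in>Pi\<^sub>E (A - {j}) B. \<Sum>v\<in>B j. F (g(j := v)))"
proof -
  have "Pi\<^sub>E A B = (\<lambda>(y, g). g(j := y)) ` (B j \<times> Pi\<^sub>E (A - {j}) B)"
    using PiE_insert_eq[of j "A - {j}" B] assms by (simp add: insert_absorb)
  moreover have "inj_on (\<lambda>(y, g). g(j := y)) (B j \<times> Pi\<^sub>E (A - {j}) B)"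
    by (rule inj_combinator) simp
  ultimately have "(\<Sum>f\<in>Pi\<^sub>E A B. F f) = (\<Sum>(v, g)\<in>B j \<times> Pi\<^sub>E (A - {j}) B. F (g(j := v)))"
    by (simp add: sum.reindex case_prod_unfold)
  also have "\<dots> = (\<Sum>v\<in>B j. \<Sum>g\<in>Pi\<^sub>E (A - {j}) B. F (g(j := v)))"
    by (rule sum.cartesian_product[symmetric])
  finally show ?thesis by (simp add: sum.swap[of _ "B j"])
qed

text \<open>Turns the distance of two signals into a lower bound on the sum of the losses of any
  estimate. The slack is twice the squared distance from \<open>e\<close> to the midpoint.\<close>

lemma sum_squares_dist_ge: "(e - a)\<^sup>2 + (e - b)\<^sup>2 \<ge> (a - b)\<^sup>2 / (2::real)"
proof -
  have "(e - a)\<^sup>2 + (e - b)\<^sup>2 - (a - b)\<^sup>2 / 2 = 2 * (e - (a + b) / 2)\<^sup>2"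
    by (simp add: power2_eq_square field_simps)
  thus ?thesis by (smt (verit) zero_le_power2)
qed

text \<open>The last of the \<open>K\<close> blocks absorbs the remainder of \<open>{..<n}\<close>. The hypotheses are the
  staircases with \<open>S = UNIV\<close>; the reference law for testing within block \<open>j\<close> has \<open>S = - {j}\<close>.\<close>

definition block :: "nat \<Rightarrow> nat \<Rightarrow> nat \<Rightarrow> nat" where
  "block m K i = min (i div m) (K - 1)"

definition staircase ::
  "nat \<Rightarrow> nat \<Rightarrow> nat \<Rightarrow> real \<Rightarrow> (nat \<Rightarrow> real) \<Rightarrow> nat set \<Rightarrow> (nat \<Rightarrow> nat) \<Rightarrow> nat \<Rightarrow> real" where
  "staircase n m K \<beta> h S l = (\<lambda>i\<in>{..<n}. let b = block m K i in
     real b * \<beta> - (if b \<in> S \<and> i < b * m + 2 ^ l b then h (l b) else 0))"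

lemma block_times_le: "block m K i * m \<le> i"
  by (metis block_def min.cobounded1 mult_le_mono1 div_times_less_eq_dividend order_trans)

lemma block_eqI:
  assumes "b < K" "b * m \<le> i" "i < b * m + m"
  shows "block m K i = b"
proof -
  have "i div m = b" using assms(2,3) by (intro div_nat_eqI) (auto simp: mult.commute)
  thus ?thesis using assms(1) by (simp add: block_def)
qed

lemma block_last:
  assumes "m > 0" "(K - 1) * m \<le> i"
  shows "block m K i = K - 1"
proof -
  have "K - 1 \<le> i div m" using assms by (simp add: less_eq_div_iff_mult_less_eq)
  thus ?thesis by (simp add: block_def)
qed

text \<open>Each block consists of a lowered piece followed by a piece at full height, which makes
  \<open>2 * K\<close> pieces; if \<open>k\<close> is odd, one empty piece is added at the end.
  Monotonicity holds because the offset \<open>\<beta>\<close> between blocks is at least every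
  drop.\<close>

lemma staircase_in_Theta_up:
  assumes "K \<ge> 1" "2 * K \<le> k" "k \<le> 2 * K + 1" "K * m \<le> n"
    and h: "\<And>v. 0 \<le> h v" "\<And>v. h v \<le> \<beta>"
    and l: "\<And>b. b < K \<Longrightarrow> 2 ^ l b \<le> m"
  shows "staircase n m K \<beta> h UNIV l \<in> Theta_up n k"
proof -
  have m: "m > 0" using l[of 0] \<open>K \<ge> 1\<close> by (metis One_nat_def Suc_le_lessD le_zero_eq neq0_conv power_not_zero zero_neq_numeral)
  \<comment> \<open>Even breakpoints start a block, odd ones end its lowered run. From
    \<open>2 * K\<close> on the value is \<open>n\<close>, so the last block takes the remainder and
    a piece \<open>2 * K + 1\<close> is empty.\<close>
  define a where "a j = (if j \<ge> 2 * K then n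
      else (j div 2) * m + (if odd j then 2 ^ l (j div 2) else 0))" for j
  \<comment> \<open>Levels are indexed from 0: piece \<open>j\<close> has level
    \<open>\<nu> (j - 1)\<close>, so even indices are the lowered ones.\<close>
  define \<nu> where "\<nu> j = real (j div 2) * \<beta> - (if even j then h (l (j div 2)) else 0)" for j
  have a_even: "a (2 * b) = b * m" if "b < K" for b using that by (simp add: a_def)
  have a_odd: "a (2 * b + 1) = b * m + 2 ^ l b" if "b < K" for b using that by (simp add: a_def)
  have Suc_le: "Suc b * m \<le> n" if "b < K" for b
    using mult_le_mono1[of "Suc b" K m] that \<open>K * m \<le> n\<close> by simp
  have a_next: "b * m + m \<le> a (2 * b + 2)" if "b < K" for b
    using Suc_le[OF that] by (auto simp: a_def)
  have a_next': "b * m + m = a (2 * b + 2)" if "Suc b < K" for b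
    using that by (simp add: a_def)
  have cases: "(\<exists>b<K. j = 2 * b + 1) \<or> (\<exists>b<K. j = 2 * b + 2) \<or> j = 2 * K + 1" if "j \<in> {1..k}" for j
  proof -
    have "j = 2 * ((j - 1) div 2) + 1 \<or> j = 2 * ((j - 1) div 2) + 2" using that by simp presburger
    moreover have "(j - 1) div 2 < K \<or> (j - 1) div 2 = K \<and> j = 2 * K + 1"
      using that \<open>k \<le> 2 * K + 1\<close> by auto
    ultimately show ?thesis by blast
  qed
  have asc: "a (j - 1) \<le> a j" if "j \<in> {1..k}" for j
    using cases[OF that]
  proof (elim disjE exE conjE)
    fix b assume "b < K" "j = 2 * b + 1"
    thus ?thesis using a_even a_odd by simp
  next
    fix b assume b: "b < K" "j = 2 * b + 2"
    hence "a (j - 1) = b * m + 2 ^ l b" using a_odd[OF b(1)] by simp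
    thus ?thesis using a_next[OF b(1)] l[OF b(1)] b(2) by simp
  qed (simp add: a_def)
  have mono: "mono \<nu>"
  proof (rule monoI, rule lift_Suc_mono_le)
    fix j show "\<nu> j \<le> \<nu> (Suc j)"
    proof (cases "even j")
      case True thus ?thesis using h(1) by (auto simp: \<nu>_def)
    next
      case False
      hence "Suc j div 2 = Suc (j div 2)" by simp
      with False show ?thesis using h(2)[of "l (Suc (j div 2))"] by (simp add: \<nu>_def algebra_simps)
    qed
  qed
  have val: "staircase n m K \<beta> h UNIV l (i - 1) = \<nu> (j - 1)"
    if "j \<in> {1..k}" "a (j - 1) < i" "i \<le> a j" for i j
    using cases[OF that(1)]
  proof (elim disjE exE conjE)
    fix b assume b: "b < K" "j = 2 * b + 1"
    hence i: "b * m < i" "i \<le> b * m + 2 ^ l b" using that(2,3) a_even a_odd by auto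
    moreover have "block m K (i - 1) = b" using i l[OF b(1)] b by (intro block_eqI) auto
    moreover have "i - 1 < n" using i l[OF b(1)] Suc_le[OF b(1)] by simp
    moreover have "i - 1 < b * m + 2 ^ l b" using i by simp
    ultimately show ?thesis using b by (simp add: staircase_def \<nu>_def)
  next
    fix b assume b: "b < K" "j = 2 * b + 2"
    hence i: "b * m + 2 ^ l b < i" "i \<le> a (2 * b + 2)" using that(2,3) a_odd[OF b(1)] by auto
    have blk: "block m K (i - 1) = b"
    \<comment> \<open>The last block may be longer than \<open>m\<close>; there the cap in
      \<open>block\<close> replaces \<open>block_eqI\<close>.\<close>
    proof (cases "Suc b < K")
      case True thus ?thesis using i a_next'[OF True] b by (intro block_eqI) auto
    next
      case False
      hence "b = K - 1" using b by simp
      thus ?thesis using i m block_last[of m K "i - 1"] by simp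
    qed
    have "a (2 * b + 2) \<le> n"
      using Suc_le[OF b(1)] a_next'[of b] by (cases "Suc b < K") (auto simp: a_def)
    hence "i - 1 < n" using i by simp
    thus ?thesis using b i blk by (simp add: staircase_def \<nu>_def)
  next
    assume "j = 2 * K + 1"
    thus ?thesis using that(2,3) by (simp add: a_def)
  qed
  show ?thesis unfolding Theta_up_def
  proof (intro CollectI conjI exI[of _ a] exI[of _ "\<lambda>j. \<nu> (j - 1)"] ballI allI impI)
    show "a 0 = 0" "a k = n" using assms by (auto simp: a_def)
    show "staircase n m K \<beta> h UNIV l \<in> extensional {..<n}" by (simp add: staircase_def)
    show "\<nu> (j - 1) \<le> \<nu> (j' - 1)" if "j \<le> j'" for j j'
      using that by (intro monoD[OF mono]) simp
  qed (use asc val in blast)+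
qed

text \<open>The signals differ only within the first \<open>2 ^ v\<close> coordinates from the start
  of block \<open>j\<close>, by \<open>h v\<close>. Only an inequality is claimed, since this run is
  not assumed to fit into the block.\<close>

lemma staircase_close:
  assumes "j < K" "\<And>v. 2 ^ v * (h v)\<^sup>2 = H"
  shows "(\<Sum>i<n. (staircase n m K \<beta> h UNIV (g(j := v)) i - staircase n m K \<beta> h (- {j}) g i)\<^sup>2) \<le> H"
proof -
  have "(staircase n m K \<beta> h UNIV (g(j := v)) i - staircase n m K \<beta> h (- {j}) g i)\<^sup>2
      \<le> (if i \<in> {j * m..<j * m + 2 ^ v} then (h v)\<^sup>2 else 0)" if "i < n" for i
    using that block_times_le[of m K i] by (auto simp: staircase_def Let_def)
  hence "(\<Sum>i<n. (staircase n m K \<beta> h UNIV (g(j := v)) i - staircase n m K \<beta> h (- {j}) g i)\<^sup>2)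
      \<le> (\<Sum>i<n. if i \<in> {j * m..<j * m + 2 ^ v} then (h v)\<^sup>2 else 0)"
    by (intro sum_mono) auto
  also have "\<dots> = (\<Sum>i\<in>{..<n} \<inter> {j * m..<j * m + 2 ^ v}. (h v)\<^sup>2)"
    by (rule sum.inter_restrict[symmetric]) simp
  also have "\<dots> \<le> (\<Sum>i\<in>{j * m..<j * m + 2 ^ v}. (h v)\<^sup>2)"
    by (intro sum_mono2) auto
  also have "\<dots> = H" using assms(2) by simp
  finally show ?thesis .
qed

text \<open>Between offsets \<open>2 ^ u\<close> and \<open>2 ^ v\<close> exactly one of the signals
  is lowered, by \<open>h v\<close>. As \<open>u < v\<close>, this is at least half of the run of
  length \<open>2 ^ v\<close>, so the squared distance is at least \<open>H / 2\<close>;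
  \<open>sum_squares_dist_ge\<close> costs another factor 2.\<close>

lemma staircase_separated:
  assumes j: "j < K" "K * m \<le> n" and H: "\<And>v. 2 ^ v * (h v)\<^sup>2 = H"
    and uv: "u < v" "2 ^ v \<le> m"
  shows "(\<Sum>i\<in>{j * m..<j * m + m}. (e i - staircase n m K \<beta> h UNIV (g(j := u)) i)\<^sup>2)
    + (\<Sum>i\<in>{j * m..<j * m + m}. (e i - staircase n m K \<beta> h UNIV (g(j := v)) i)\<^sup>2) \<ge> H / 4"
proof -
  let ?\<theta> = "\<lambda>v. staircase n m K \<beta> h UNIV (g(j := v))"
  let ?I = "{j * m + 2 ^ u..<j * m + 2 ^ v}"
  have "Suc j * m \<le> K * m" using j by (intro mult_le_mono1) auto
  hence n: "j * m + m \<le> n" using j by simp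
  have pw: "(2::nat) * 2 ^ u \<le> 2 ^ v" using power_increasing[of "Suc u" v "2::nat"] uv by simp
  hence "real (2 * 2 ^ u) \<le> real (2 ^ v)" by (simp only: of_nat_le_iff)
  hence "2 ^ v / 2 \<le> real (2 ^ v - 2 ^ u)" 
    by (subst of_nat_diff) (use uv in \<open>auto intro: power_increasing\<close>)
  hence "2 ^ v / 2 * ((h v)\<^sup>2 / 2) \<le> real (2 ^ v - 2 ^ u) * ((h v)\<^sup>2 / 2)"
    by (rule mult_right_mono) simp
  also have "2 ^ v / 2 * ((h v)\<^sup>2 / 2) = H / 4" using H[of v] by simp
  also have "real (2 ^ v - 2 ^ u) * ((h v)\<^sup>2 / 2) = (\<Sum>i\<in>?I. (h v)\<^sup>2 / 2)" by simp
  also have "\<dots> \<le> (\<Sum>i\<in>?I. (e i - ?\<theta> u i)\<^sup>2 + (e i - ?\<theta> v i)\<^sup>2)"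
  proof (rule sum_mono)
    fix i assume i: "i \<in> ?I"
    hence "block m K i = j" using uv j by (intro block_eqI) auto
    hence "?\<theta> u i - ?\<theta> v i = h v" using i n uv by (simp add: staircase_def)
    thus "(h v)\<^sup>2 / 2 \<le> (e i - ?\<theta> u i)\<^sup>2 + (e i - ?\<theta> v i)\<^sup>2"
      using sum_squares_dist_ge[of "?\<theta> u i" "?\<theta> v i" "e i"] by simp
  qed
  also have "\<dots> \<le> (\<Sum>i\<in>{j * m..<j * m + m}. (e i - ?\<theta> u i)\<^sup>2 + (e i - ?\<theta> v i)\<^sup>2)"
    using uv by (intro sum_mono2) auto
  finally show ?thesis by (simp add: sum.distrib)
qed

section \<open>Risk bounds, from one block to the whole signal\<close>

text \<open>The testing bound with \<open>d = H / 4\<close>. All other blocks are frozen at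
  \<open>g\<close>, also in the reference signal, so the \<open>M\<close> laws differ only through
  block \<open>j\<close>.\<close>

lemma staircase_block_risk:
  fixes est :: "(nat \<Rightarrow> real) \<Rightarrow> nat \<Rightarrow> real" and K m M n :: nat
  assumes "\<sigma> > 0" and est: "\<And>i. i < n \<Longrightarrow> (\<lambda>x. est x i) \<in> borel_measurable (PiM {..<n} (\<lambda>_. lborel))"
    and j: "j < K" "K * m \<le> n" and M: "M \<ge> 2" "2 ^ (M - 1) \<le> m"
    and H: "\<And>v. 2 ^ v * (h v)\<^sup>2 = H" "H = \<sigma>\<^sup>2 * (ln M / 2)"
  shows "(\<Sum>v<M. \<integral>\<^sup>+x. ennreal (\<Sum>i\<in>{j * m..<j * m + m}.
        (est x i - staircase n m K \<beta> h UNIV (g(j := v)) i)\<^sup>2)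
        \<partial>gauss_vec n \<sigma> (staircase n m K \<beta> h UNIV (g(j := v))))
    \<ge> ennreal (H / 8 * (1 - 2 powr (-1/4)) * M)"
proof -
  let ?\<theta> = "\<lambda>v. staircase n m K \<beta> h UNIV (g(j := v))"
  let ?w = "\<lambda>v x. \<Sum>i\<in>{j * m..<j * m + m}. (est x i - ?\<theta> v i)\<^sup>2"
  have "Suc j * m \<le> K * m" using j by (intro mult_le_mono1) auto
  hence n: "j * m + m \<le> n" using j by simp
  have le_m: "2 ^ v \<le> m" if "v < M" for v
  proof -
    have "2 ^ v \<le> (2::nat) ^ (M - 1)" using that by (intro power_increasing) auto
    thus ?thesis using M(2) by (rule order_trans)
  qed
  have sep: "?w u x + ?w v x \<ge> H / 4" if "u < M" "v < M" "u \<noteq> v" for u v x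
    using that staircase_separated[OF j H(1), of u v "est x" \<beta> g]
      staircase_separated[OF j H(1), of v u "est x" \<beta> g] le_m
    by (cases u v rule: linorder_cases) auto
  have "ennreal (H / 4 / 2 * (1 - 2 powr (-1/4)) * card {..<M})
    \<le> (\<Sum>v<M. \<integral>\<^sup>+x. ennreal (?w v x) \<partial>gauss_vec n \<sigma> (?\<theta> v))"
  proof (rule gaussian_testing_lower_bound[where \<eta> = "staircase n m K \<beta> h (- {j}) g"])
    show "0 < H / 4" unfolding H(2) using \<open>\<sigma> > 0\<close> M(1) by simp
    show "?w v \<in> borel_measurable (PiM {..<n} (\<lambda>_. lborel))" for v
      using n by (intro borel_measurable_sum borel_measurable_power borel_measurable_diff est) auto
    show "(\<Sum>i<n. (?\<theta> v i - staircase n m K \<beta> h (- {j}) g i)\<^sup>2) \<le> \<sigma>\<^sup>2 * (ln (card {..<M}) / 2)" for v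
      using staircase_close[OF j(1) H(1)] H(2) by simp
  qed (use M \<open>\<sigma> > 0\<close> sep in \<open>auto intro!: sum_nonneg\<close>)
  thus ?thesis by simp
qed

text \<open>The supremum dominates the average over all \<open>M ^ K\<close> staircases. The loss
  splits over blocks, and for each block the average over its own scale is bounded below uniformly
  in the other choices.\<close>

lemma sup_risk_ge:
  fixes est :: "(nat \<Rightarrow> real) \<Rightarrow> nat \<Rightarrow> real" and K k m M n :: nat
  assumes "\<sigma> > 0" and est: "\<And>i. i < n \<Longrightarrow> (\<lambda>x. est x i) \<in> borel_measurable (PiM {..<n} (\<lambda>_. lborel))"
    and K: "K \<ge> 1" "2 * K \<le> k" "k \<le> 2 * K + 1" "K * m \<le> n"
    and M: "M \<ge> 2" "2 ^ (M - 1) \<le> m"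
  shows "(SUP \<theta>\<in>Theta_up n k. risk n \<sigma> est \<theta>)
    \<ge> ennreal (K * (\<sigma>\<^sup>2 * ln M / 16 * (1 - 2 powr (-1/4))))"
proof -
  define H where "H = \<sigma>\<^sup>2 * (ln M / 2)"
  \<comment> \<open>The drop makes the energy \<open>2 ^ v * (h v)\<^sup>2\<close> equal to
    \<open>H\<close> at every scale. The largest drop is \<open>h 0 = sqrt H\<close>, which
    therefore serves as the offset between blocks.\<close>
  define h where "h v = sqrt (H / 2 ^ v)" for v :: nat
  define C where "C = H / 8 * (1 - 2 powr (-1/4))"
  let ?\<theta> = "staircase n m K (sqrt H) h UNIV"
  let ?S = "SUP \<theta>\<in>Theta_up n k. risk n \<sigma> est \<theta>"
  let ?L = "Pi\<^sub>E {..<K} (\<lambda>_. {..<M})"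
  let ?w = "\<lambda>j l x. \<Sum>i\<in>{j * m..<j * m + m}. (est x i - ?\<theta> l i)\<^sup>2"
  have H: "H \<ge> 0" using M by (simp add: H_def)
  have "2 powr (-1/4) \<le> (1::real)" using powr_mono[of "-1/4" 0 "2::real"] by simp
  hence C: "C \<ge> 0" using H by (simp add: C_def)
  have hH: "2 ^ v * (h v)\<^sup>2 = H" for v using H by (simp add: h_def)
  have h: "0 \<le> h v" "h v \<le> sqrt H" for v
    using H by (auto simp: h_def pos_divide_le_eq mult_le_cancel_left1)
  have in_Theta: "?\<theta> l \<in> Theta_up n k" if "l \<in> ?L" for l
  proof (rule staircase_in_Theta_up[OF K])
    fix b assume "b < K"
    hence "l b < M" using that by (auto simp: PiE_iff)
    hence "l b \<le> M - 1" by simp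
    hence "2 ^ l b \<le> (2::nat) ^ (M - 1)" by (rule power_increasing) simp
    thus "2 ^ l b \<le> m" using M(2) by (rule order_trans)
  qed (use h in auto)
  have sub: "j * m + m \<le> n" if "j < K" for j
    using mult_le_mono1[of "Suc j" K m] that K by simp
  have wm: "?w j l \<in> borel_measurable (gauss_vec n \<sigma> (?\<theta> l))" if "j < K" for j l
  proof -
    have "?w j l \<in> borel_measurable (PiM {..<n} (\<lambda>_. lborel))"
      using sub[OF that] by (intro borel_measurable_sum borel_measurable_power borel_measurable_diff est) auto
    thus ?thesis by (simp add: gauss_vec_eq_density[OF \<open>\<sigma> > 0\<close>])
  qed
  have blocks: "(\<Sum>j<K. \<integral>\<^sup>+x. ennreal (?w j l x) \<partial>gauss_vec n \<sigma> (?\<theta> l)) \<le> risk n \<sigma> est (?\<theta> l)" for l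
  proof -
    have "(\<Sum>j<K. \<integral>\<^sup>+x. ennreal (?w j l x) \<partial>gauss_vec n \<sigma> (?\<theta> l))
      = (\<integral>\<^sup>+x. (\<Sum>j<K. ennreal (?w j l x)) \<partial>gauss_vec n \<sigma> (?\<theta> l))"
      using wm by (intro nn_integral_sum[symmetric]) auto
    also have "\<dots> \<le> risk n \<sigma> est (?\<theta> l)"
      unfolding risk_def
    proof (rule nn_integral_mono)
      fix x
      have "(\<Sum>j<K. ennreal (?w j l x)) = ennreal (\<Sum>j<K. ?w j l x)"
        by (intro sum_ennreal sum_nonneg) auto
      \<comment> \<open>The length-\<open>m\<close> windows tile \<open>{..<K * m}\<close>; the loss
        on the remaining coordinates is discarded.\<close>
      also have "(\<Sum>j<K. ?w j l x) = (\<Sum>i<K * m. (est x i - ?\<theta> l i)\<^sup>2)"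
        by (rule sum.nat_group)
      also have "\<dots> \<le> (\<Sum>i<n. (est x i - ?\<theta> l i)\<^sup>2)"
        using K by (intro sum_mono2) auto
      finally show "(\<Sum>j<K. ennreal (?w j l x)) \<le> ennreal (\<Sum>i<n. (est x i - ?\<theta> l i)\<^sup>2)"
        by (simp add: ennreal_leI)
    qed
    finally show ?thesis .
  qed
  \<comment> \<open>For each of the \<open>K\<close> blocks there are \<open>M ^ (K - 1)\<close>
    frozen choices elsewhere, each contributing \<open>C * M\<close>.\<close>
  have "ennreal (real M ^ K) * ennreal (K * C) = ennreal (K * (M ^ (K - 1) * (C * M)))"
  proof -
    have "real M ^ K = real M ^ (K - 1) * M" using K(1) by (cases K) auto
    hence "real M ^ K * (K * C) = K * (M ^ (K - 1) * (C * M))" by simp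
    thus ?thesis using C by (subst ennreal_mult[symmetric]) auto
  qed
  also have "\<dots> = (\<Sum>j<K. \<Sum>g\<in>Pi\<^sub>E ({..<K} - {j}) (\<lambda>_. {..<M}). ennreal (C * M))"
    using C by (simp add: card_PiE ennreal_mult ennreal_of_nat_eq_real_of_nat)
  also have "\<dots> \<le> (\<Sum>j<K. \<Sum>g\<in>Pi\<^sub>E ({..<K} - {j}) (\<lambda>_. {..<M}).
      \<Sum>v<M. \<integral>\<^sup>+x. ennreal (?w j (g(j := v)) x) \<partial>gauss_vec n \<sigma> (?\<theta> (g(j := v))))"
  proof (rule sum_mono, rule sum_mono)
    fix j g assume "j \<in> {..<K}"
    hence "j < K" by simp
    from staircase_block_risk[OF \<open>\<sigma> > 0\<close> est this K(4) M hH H_def]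
    show "ennreal (C * M) \<le> (\<Sum>v<M. \<integral>\<^sup>+x. ennreal (?w j (g(j := v)) x)
        \<partial>gauss_vec n \<sigma> (?\<theta> (g(j := v))))"
      unfolding C_def .
  qed
  also have "\<dots> = (\<Sum>j<K. \<Sum>l\<in>?L. \<integral>\<^sup>+x. ennreal (?w j l x) \<partial>gauss_vec n \<sigma> (?\<theta> l))"
    by (rule sum.cong[OF refl],
        rule sum_PiE_remove[symmetric, where A = "{..<K}" and B = "\<lambda>_. {..<M}" and
          F = "\<lambda>l. \<integral>\<^sup>+x. ennreal (?w j l x) \<partial>gauss_vec n \<sigma> (?\<theta> l)" for j])
  also have "\<dots> = (\<Sum>l\<in>?L. \<Sum>j<K. \<integral>\<^sup>+x. ennreal (?w j l x) \<partial>gauss_vec n \<sigma> (?\<theta> l))"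
    by (rule sum.swap)
  also have "\<dots> \<le> (\<Sum>l\<in>?L. ?S)"
    by (rule sum_mono, rule order_trans[OF blocks], rule SUP_upper, rule in_Theta)
  also have "\<dots> = ennreal (real M ^ K) * ?S"
    by (simp add: card_PiE ennreal_of_nat_eq_real_of_nat)
  finally have "ennreal (K * C) \<le> ?S"
    using M by (subst (asm) ennreal_mult_le_mult_iff) auto
  thus ?thesis by (simp add: C_def H_def algebra_simps)
qed

text \<open>Tests the zero signal against a constant one of squared norm \<open>H\<close>, the
  largest that the testing bound allows for two hypotheses. The zero signal doubles as the
  reference, and the separation is \<open>H / 2\<close>.\<close>

lemma sup_risk_const_ge:
  fixes est :: "(nat \<Rightarrow> real) \<Rightarrow> nat \<Rightarrow> real"
  assumes "\<sigma> > 0" "n \<ge> 1"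
    and est: "\<And>i. i < n \<Longrightarrow> (\<lambda>x. est x i) \<in> borel_measurable (PiM {..<n} (\<lambda>_. lborel))"
  shows "(SUP \<theta>\<in>Theta_up n 1. risk n \<sigma> est \<theta>)
    \<ge> ennreal (\<sigma>\<^sup>2 * ln 2 / 8 * (1 - 2 powr (-1/4)))"
proof -
  define H where "H = \<sigma>\<^sup>2 * (ln 2 / 2)"
  define h where "h v = (if v then sqrt (H / n) else 0)" for v :: bool
  let ?\<theta> = "\<lambda>v. \<lambda>i\<in>{..<n}. h v"
  let ?S = "SUP \<theta>\<in>Theta_up n 1. risk n \<sigma> est \<theta>"
  define r where "r = H / 4 * (1 - 2 powr (-1/4))"
  have H: "H > 0" using \<open>\<sigma> > 0\<close> by (simp add: H_def)
  have h2: "real n * (h True)\<^sup>2 = H" using H \<open>n \<ge> 1\<close> by (simp add: h_def)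
  have in_Theta: "?\<theta> v \<in> Theta_up n 1" for v
    unfolding Theta_up_def
    by (intro CollectI conjI exI[of _ "\<lambda>j. if j = 0 then 0 else n"] exI[of _ "\<lambda>_. h v"]) auto
  have sep: "(\<Sum>i<n. (est x i - ?\<theta> u i)\<^sup>2) + (\<Sum>i<n. (est x i - ?\<theta> v i)\<^sup>2) \<ge> H / 2"
    if "u \<noteq> v" for u v x
  proof -
    have "H / 2 = (\<Sum>i<n. (?\<theta> u i - ?\<theta> v i)\<^sup>2 / 2)"
      using that h2 by (cases u; cases v) (simp_all add: h_def)
    also have "\<dots> \<le> (\<Sum>i<n. (est x i - ?\<theta> u i)\<^sup>2 + (est x i - ?\<theta> v i)\<^sup>2)"
      by (intro sum_mono sum_squares_dist_ge)
    finally show ?thesis by (simp add: sum.distrib)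
  qed
  have "ennreal (H / 2 / 2 * (1 - 2 powr (-1/4)) * card (UNIV :: bool set))
      \<le> (\<Sum>v\<in>UNIV. \<integral>\<^sup>+x. ennreal (\<Sum>i<n. (est x i - ?\<theta> v i)\<^sup>2) \<partial>gauss_vec n \<sigma> (?\<theta> v))"
  proof (rule gaussian_testing_lower_bound[where \<eta> = "?\<theta> False"])
    show "(\<lambda>x. \<Sum>i<n. (est x i - ?\<theta> v i)\<^sup>2) \<in> borel_measurable (PiM {..<n} (\<lambda>_. lborel))" for v
      by (intro borel_measurable_sum borel_measurable_power borel_measurable_diff est) auto
    show "(\<Sum>i<n. (?\<theta> v i - ?\<theta> False i)\<^sup>2) \<le> \<sigma>\<^sup>2 * (ln (card (UNIV :: bool set)) / 2)" for v
      using h2 H by (cases v) (simp_all add: h_def H_def)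
  qed (use \<open>\<sigma> > 0\<close> H sep in \<open>auto intro!: sum_nonneg\<close>)
  also have "\<dots> = (\<Sum>v\<in>UNIV. risk n \<sigma> est (?\<theta> v))" by (simp only: risk_def)
  also have "\<dots> \<le> (\<Sum>v\<in>(UNIV :: bool set). ?S)"
    by (intro sum_mono SUP_upper in_Theta)
  finally have "ennreal (r * 2) \<le> 2 * ?S" by (simp add: r_def)
  moreover have "r \<ge> 0" using H powr_mono[of "-1/4" 0 "2::real"] by (simp add: r_def)
  ultimately have "2 * ennreal r \<le> 2 * ?S" by (simp add: ennreal_mult mult.commute)
  hence "ennreal r \<le> ?S" by (subst (asm) ennreal_mult_le_mult_iff) auto
  thus ?thesis by (simp add: r_def H_def algebra_simps)
qed

section \<open>Choice of scales and of the constant\<close>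

text \<open>Takes \<open>M = L + 1\<close> with \<open>2 ^ L\<close> the largest power of 2 not
  above \<open>m\<close>. Then \<open>16 * n / k\<close> is below \<open>2 ^ (L + 4)\<close>, so its
  iterated logarithm is at most a multiple of \<open>ln M\<close>.\<close>

lemma dyadic_scales:
  assumes "2 \<le> k" "k \<le> n" "K = k div 2" "m = n div K"
  obtains M :: nat where "M \<ge> 2" "2 ^ (M - 1) \<le> m"
    "real k * ln (ln (16 * real n / real k)) \<le> 9 * (real K * ln M)"
proof -
  have K: "K \<ge> 1" "2 * K \<le> k" "k \<le> 2 * K + 1" using assms by auto
  have m: "m \<ge> 2" using K assms by (simp add: less_eq_div_iff_mult_less_eq)
  obtain L where L: "2 ^ L \<le> m" "m < 2 ^ Suc L"
    using ex_power_ivl1[of 2 m] m by auto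
  have "L \<noteq> 0" using L m by (auto intro: ccontr)
  have "n < K * Suc m" using assms K dividend_less_times_div[of K n] by simp
  also have "\<dots> \<le> K * 2 ^ Suc L" using L by (intro mult_le_mono2) simp
  finally have "2 * n < k * 2 ^ Suc L" 
    using K(2) mult_le_mono1[of "2 * K" k "2 ^ Suc L"] by linarith
  hence "real (2 * n) < real (k * 2 ^ Suc L)" by (simp only: of_nat_less_iff)
  hence "16 * real n / real k < 2 ^ (L + 4)"
    using assms(1) by (simp add: pos_divide_less_eq power_add mult.commute)
  moreover have ge: "16 * real n / real k \<ge> 16" using assms by (simp add: pos_le_divide_eq)
  ultimately have "ln (16 * real n / real k) < ln (2 ^ (L + 4))"
    by simp
  also have "\<dots> = real (L + 4) * ln 2" by (rule ln_realpow)
  also have "\<dots> \<le> real (L + 4) * 1" using ln_2_less_1 by (intro mult_left_mono) auto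
  \<comment> \<open>Uses \<open>L \<ge> 1\<close>. The cube absorbs the additive constant and
    becomes a factor 3 under the outer logarithm.\<close>
  also have "\<dots> \<le> real (Suc L) ^ 3"
  proof -
    have "L + 4 \<le> Suc L ^ 3" using \<open>L \<noteq> 0\<close> by (cases L) (auto simp: power3_eq_cube algebra_simps)
    thus ?thesis by (metis mult.right_neutral of_nat_le_iff of_nat_power)
  qed
  finally have "ln (16 * real n / real k) \<le> real (Suc L) ^ 3" by simp
  moreover have pos: "ln (16 * real n / real k) > 0" using ge by (intro ln_gt_zero) auto
  ultimately have "ln (ln (16 * real n / real k)) \<le> ln (real (Suc L) ^ 3)"
    by (subst ln_le_cancel_iff) auto
  also have "\<dots> = 3 * ln (Suc L)" by (subst ln_realpow) auto
  finally have "real k * ln (ln (16 * real n / real k)) \<le> real k * (3 * ln (Suc L))"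
    by (intro mult_left_mono) auto
  \<comment> \<open>\<open>k \<le> 2 * K + 1 \<le> 3 * K\<close>; together with the 3 from the cube
    this gives the factor 9.\<close>
  also have "\<dots> \<le> (3 * real K) * (3 * ln (Suc L))"
    using K by (intro mult_right_mono) auto
  finally have "real k * ln (ln (16 * real n / real k)) \<le> 9 * (real K * ln (Suc L))" by simp
  thus ?thesis using L \<open>L \<noteq> 0\<close> by (intro that[of "Suc L"]) auto
qed

theorem mainTheorem3:
  shows "\<exists>c>0. \<forall>(n::nat) (k::nat) (\<sigma>::real) (est :: (nat \<Rightarrow> real) \<Rightarrow> (nat \<Rightarrow> real)).
     1 \<le> k \<longrightarrow> k \<le> n \<longrightarrow> \<sigma> > 0 \<longrightarrow>
     (\<forall>i<n. (\<lambda>x. est x i) \<in> borel_measurable (PiM {..<n} (\<lambda>_. lborel))) \<longrightarrow>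
     (SUP \<theta>\<in>Theta_up n k. risk n \<sigma> est \<theta>) \<ge>
       ennreal (if k = 1 then c * \<sigma>\<^sup>2
                else c * \<sigma>\<^sup>2 * real k * ln (ln (16 * real n / real k)))"
proof -
  define \<gamma> :: real where "\<gamma> = 1 - 2 powr (-1/4)"
  \<comment> \<open>\<open>144 = 16 * 9\<close> combines the constants of \<open>sup_risk_ge\<close>
    and \<open>dyadic_scales\<close>; the factor \<open>ln 2\<close> makes the same \<open>c\<close>
    serve \<open>k = 1\<close>.\<close>
  define c where "c = \<gamma> * ln 2 / 144"
  have "2 powr (-1/4) < (1::real)" by (simp add: powr_less_one)
  hence \<gamma>: "\<gamma> > 0" by (simp add: \<gamma>_def)
  have ln2: "0 < ln (2::real)" "ln (2::real) \<le> 1" using ln_2_less_1 by auto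
  have c: "c > 0" "c \<le> \<gamma> * ln 2 / 8" "c \<le> \<gamma> / 144"
    using \<gamma> ln2 by (auto simp: c_def)
  show ?thesis
  proof (intro exI[of _ c] conjI c(1) allI impI)
    fix n k :: nat and \<sigma> :: real and est :: "(nat \<Rightarrow> real) \<Rightarrow> nat \<Rightarrow> real"
    assume k: "1 \<le> k" "k \<le> n" and "\<sigma> > 0"
      and "\<forall>i<n. (\<lambda>x. est x i) \<in> borel_measurable (PiM {..<n} (\<lambda>_. lborel))"
    hence est: "\<And>i. i < n \<Longrightarrow> (\<lambda>x. est x i) \<in> borel_measurable (PiM {..<n} (\<lambda>_. lborel))" by blast
    let ?S = "SUP \<theta>\<in>Theta_up n k. risk n \<sigma> est \<theta>"
    show "ennreal (if k = 1 then c * \<sigma>\<^sup>2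
        else c * \<sigma>\<^sup>2 * real k * ln (ln (16 * real n / real k))) \<le> ?S"
    proof (cases "k = 1")
      case True
      have "c * \<sigma>\<^sup>2 \<le> \<gamma> * ln 2 / 8 * \<sigma>\<^sup>2" using c by (intro mult_right_mono) auto
      hence "ennreal (c * \<sigma>\<^sup>2) \<le> ennreal (\<sigma>\<^sup>2 * ln 2 / 8 * (1 - 2 powr (-1/4)))"
        unfolding \<gamma>_def by (intro ennreal_leI) (simp add: mult_ac)
      also have "\<dots> \<le> ?S" using sup_risk_const_ge[OF \<open>\<sigma> > 0\<close> _ est] k True by simp
      finally show ?thesis using True by simp
    next
      case False
      hence k2: "2 \<le> k" using k by simp
      define K where "K = k div 2"
      define m where "m = n div K"
      obtain M :: nat where M: "M \<ge> 2" "2 ^ (M - 1) \<le> m"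
        and le: "real k * ln (ln (16 * real n / real k)) \<le> 9 * (real K * ln M)"
        using dyadic_scales[OF k2 k(2) K_def m_def] by blast
      have "c * \<sigma>\<^sup>2 * (real k * ln (ln (16 * real n / real k))) \<le> c * \<sigma>\<^sup>2 * (9 * (real K * ln M))"
        using c le by (intro mult_left_mono) auto
      also have "\<dots> \<le> \<gamma> / 144 * \<sigma>\<^sup>2 * (9 * (real K * ln M))"
        using c M by (intro mult_right_mono) auto
      also have "\<dots> = K * (\<sigma>\<^sup>2 * ln M / 16 * (1 - 2 powr (-1/4)))"
        by (simp add: \<gamma>_def)
      finally have "ennreal (c * \<sigma>\<^sup>2 * real k * ln (ln (16 * real n / real k)))
          \<le> ennreal (K * (\<sigma>\<^sup>2 * ln M / 16 * (1 - 2 powr (-1/4))))"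
        by (intro ennreal_leI) (simp add: mult.assoc)
      also have "\<dots> \<le> ?S"
        using k2 by (intro sup_risk_ge[OF \<open>\<sigma> > 0\<close> est _ _ _ _ M]) (auto simp: K_def m_def)
      finally show ?thesis using False by simp
    qed
  qed
qed

end
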